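(* There exists a set $A\subset\mathbb{N}$ such that $A=\Pr(\Pr(A))$.
   Context: For $m\in\mathbb{N}$, $D(m)$ is the set of positive divisors of $m$. For $A\subset\mathbb{N}$, $S_A=\sum_{a\in A}a$ ($S_\emptyset=0$, $S_A=+\infty$ for infinite $A$), and $A$ is a practical set if every non-negative integer $k\le S_A$ is a sum of distinct elements of $A$. A number $m\in\mathbb{N}$ is $A$-practical if $D(m)\cap A$ is a practical set, and $\Pr(A)$ is the set of all $A$-practical numbers. *)

theory Defs
  imports Main "HOL-Library.Extended_Nat"
begin

text \<open>The set of natural numbers of the paper is that of the positive integers; subsets of it are
  rendered as sets \<open>A :: nat set\<close> with \<open>A \<subseteq> {0<..}\<close>.\<close>

definition pos_divisors :: "nat \<Rightarrow> nat set" where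
  "pos_divisors m = {d. d > 0 \<and> d dvd m}"

definition set_total :: "nat set \<Rightarrow> enat" where
  "set_total A = (if finite A then enat (\<Sum>a\<in>A. a) else \<infinity>)"

definition practical_set :: "nat set \<Rightarrow> bool" where
  "practical_set A \<longleftrightarrow>
     (\<forall>k::nat. enat k \<le> set_total A \<longrightarrow> (\<exists>B. finite B \<and> B \<subseteq> A \<and> (\<Sum>b\<in>B. b) = k))"

definition practical_wrt :: "nat set \<Rightarrow> nat \<Rightarrow> bool" where
  "practical_wrt A m \<longleftrightarrow> practical_set (pos_divisors m \<inter> A)"

definition Pr :: "nat set \<Rightarrow> nat set" where
  "Pr A = {m. m > 0 \<and> practical_wrt A m}"

end

theory Submission
  imports Defs
begin

text \<open>Whether a positive \<open>m\<close> lies in \<open>Pr A\<close> depends only on the divisors of \<open>m\<close> in \<open>A\<close>, and,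
  with the proper divisors fixed, it depends antitonically on whether \<open>m \<in> A\<close>: a practical set
  stays practical when its largest element is removed. So the pair of conditions
  \<open>m \<in> B \<longleftrightarrow> m \<in> Pr A\<close> and \<open>m \<in> A \<longleftrightarrow> m \<in> Pr B\<close> is always solvable for the two truth values
  \<open>m \<in> A\<close> and \<open>m \<in> B\<close>, and \<open>A\<close>, \<open>B\<close> with \<open>B = Pr A\<close>, \<open>A = Pr B\<close> arise by recursion on \<open>m\<close>.\<close>

lemma practical_set_finite_iff:
  assumes "finite A"
  shows "practical_set A \<longleftrightarrow> (\<forall>k\<le>\<Sum>A. \<exists>B\<subseteq>A. \<Sum>B = k)"
proof -
  have "finite B \<and> B \<subseteq> A \<longleftrightarrow> B \<subseteq> A" for B
    using finite_subset[OF _ assms] by blast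
  then show ?thesis
    unfolding practical_set_def set_total_def using assms by (simp flip: conj_assoc)
qed

text \<open>With \<open>s\<close> the sum of the elements below \<open>a\<close>, if
  \<open>Suc s < a\<close> then any summands of \<open>Suc s\<close> lie below \<open>a\<close> and
  so add up to at most \<open>s\<close>.\<close>

lemma practical_set_gap:
  assumes fin: "finite A" and prac: "practical_set A" and "a \<in> A"
  shows "a \<le> Suc (\<Sum>{x\<in>A. x < a})"
proof (rule ccontr)
  let ?s = "\<Sum>{x\<in>A. x < a}"
  assume "\<not> a \<le> Suc ?s"
  then have gap: "Suc ?s < a" by simp
  have "a \<le> \<Sum>A" using member_le_sum[OF \<open>a \<in> A\<close> _ fin, of "\<lambda>x. x"] by simp
  then obtain B where B: "B \<subseteq> A" "\<Sum>B = Suc ?s"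
    using prac gap unfolding practical_set_finite_iff[OF fin] by (meson less_imp_le order_trans)
  have "finite B" using B(1) fin finite_subset by blast
  have "B \<subseteq> {x\<in>A. x < a}"
    using B gap member_le_sum[OF _ _ \<open>finite B\<close>, of _ "\<lambda>x. x"] by fastforce
  then have "\<Sum>B \<le> ?s" using fin by (intro sum_mono2) auto
  then show False using B(2) by simp
qed

text \<open>This is the converse of the gap bound. Elements are added in increasing order; a target
  beyond the old total uses the new maximum \<open>b\<close>, and the old set supplies the
  rest.\<close>

lemma practical_set_if_gap:
  fixes A :: "nat set"
  assumes "finite A" and "\<And>a. a \<in> A \<Longrightarrow> a \<le> Suc (\<Sum>{x\<in>A. x < a})"
  shows "practical_set A"
  using assms
proof (induction A rule: finite_linorder_max_induct)
  case empty
  then show ?case by (simp add: practical_set_finite_iff)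
next
  case (insert b A)
  have below: "{x \<in> insert b A. x < a} = {x \<in> A. x < a}" if "a \<in> insert b A" for a
    using that insert.hyps(2) by fastforce
  have "practical_set A" using insert.IH insert.prems below by fastforce
  then have A: "\<exists>B\<subseteq>A. \<Sum>B = k" if "k \<le> \<Sum>A" for k
    using that by (simp add: practical_set_finite_iff[OF insert.hyps(1)])
  have "{x \<in> A. x < b} = A" using insert.hyps(2) by blast
  then have b: "b \<le> Suc (\<Sum>A)" using insert.prems[of b] below[of b] by simp
  have "b \<notin> A" using insert.hyps(2) by blast
  have "\<exists>B\<subseteq>insert b A. \<Sum>B = k" if k: "k \<le> \<Sum>(insert b A)" for k
  proof (cases "k \<le> \<Sum>A")
    case True
    then show ?thesis using A by blast
  next
    case False
    then have "k - b \<le> \<Sum>A" using k \<open>b \<notin> A\<close> insert.hyps(1) by simp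
    then obtain B where B: "B \<subseteq> A" "\<Sum>B = k - b" using A by blast
    have "finite B" "b \<notin> B" using B(1) \<open>b \<notin> A\<close> insert.hyps(1) finite_subset by blast+
    \<comment> \<open>Here \<open>\<Sum>A < k\<close> and \<open>b \<le> Suc (\<Sum>A)\<close> give
      \<open>b \<le> k\<close>, so the subtraction \<open>k - b\<close> is not truncated.\<close>
    then have "\<Sum>(insert b B) = k" using B(2) b False by simp
    then show ?thesis using B(1) by blast
  qed
  then show ?case using insert.hyps(1) by (simp add: practical_set_finite_iff)
qed

text \<open>The gap bound at an element mentions only smaller elements, so deleting the maximum
  leaves all other bounds intact.\<close>

lemma practical_set_remove_Max:
  fixes A :: "nat set"
  assumes fin: "finite A" and less: "\<And>a. a \<in> A \<Longrightarrow> a < m" and prac: "practical_set (insert m A)"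
  shows "practical_set A"
proof (rule practical_set_if_gap[OF fin])
  fix a assume a: "a \<in> A"
  have "{x \<in> insert m A. x < a} = {x \<in> A. x < a}" using less[OF a] by auto
  then show "a \<le> Suc (\<Sum>{x\<in>A. x < a})"
    using practical_set_gap[OF _ prac, of a] fin a by simp
qed

text \<open>The composite of two antitone maps is monotone, hence has a fixed point
  \<open>a\<close>; then \<open>b = F a\<close>.\<close>

lemma antitone_bool_pair:
  fixes F G :: "bool \<Rightarrow> bool"
  assumes "F True \<Longrightarrow> F False" and "G True \<Longrightarrow> G False"
  shows "\<exists>a b. b = F a \<and> a = G b"
proof -
  \<comment> \<open>Iterating the monotone composite from the least element \<open>False\<close>
    stabilises after one step, as \<open>bool\<close> has only two values.\<close>
  have "G (F (G (F False))) = G (F False)"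
    using assms by (cases "F True"; cases "F False"; cases "G True"; cases "G False") simp_all
  then show ?thesis by metis
qed

text \<open>The membership of \<open>m\<close> is kept as a separate argument because it is the
  unknown to be solved for at stage \<open>m\<close>.\<close>

definition insert_if :: "bool \<Rightarrow> 'a \<Rightarrow> 'a set \<Rightarrow> 'a set" where
  "insert_if c x A = (if c then insert x A else A)"

definition proper_divisors_in :: "(nat \<Rightarrow> bool) \<Rightarrow> nat \<Rightarrow> nat set" where
  "proper_divisors_in p m = {d. 0 < d \<and> d < m \<and> d dvd m \<and> p d}"

lemma proper_divisors_in_cong:
  "(\<And>d. d < m \<Longrightarrow> p d = q d) \<Longrightarrow> proper_divisors_in p m = proper_divisors_in q m"
  by (auto simp: proper_divisors_in_def)

lemma practical_set_insert_if_antitone: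
  "practical_set (insert_if True m (proper_divisors_in p m)) \<Longrightarrow>
   practical_set (insert_if False m (proper_divisors_in p m))"
  unfolding insert_if_def if_True if_False
  by (rule practical_set_remove_Max) (simp_all add: proper_divisors_in_def)

lemma pos_divisors_Int_Collect:
  assumes "m > 0"
  shows "pos_divisors m \<inter> {n. 0 < n \<and> p n} = insert_if (p m) m (proper_divisors_in p m)"
  using assms
  by (auto simp: pos_divisors_def insert_if_def proper_divisors_in_def le_less dest: dvd_imp_le)

lemma Pr_Collect_eq:
  assumes "\<And>m. m > 0 \<Longrightarrow> q m = practical_set (insert_if (p m) m (proper_divisors_in p m))"
  shows "Pr {n. 0 < n \<and> p n} = {n. 0 < n \<and> q n}"
  using assms by (auto simp: Pr_def practical_wrt_def pos_divisors_Int_Collect)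

theorem theorem4p15: "\<exists>A::nat set. A \<subseteq> {0<..} \<and> A = Pr (Pr A)"
proof -
  define S where "S f m r \<longleftrightarrow>
      snd r = practical_set (insert_if (fst r) m (proper_divisors_in (fst \<circ> f) m)) \<and>
      fst r = practical_set (insert_if (snd r) m (proper_divisors_in (snd \<circ> f) m))"
    for f :: "nat \<Rightarrow> bool \<times> bool" and m r
  have "\<exists>f. \<forall>m. S f m (f m)"
  \<comment> \<open>Only solvability at each \<open>m\<close> is known, not uniqueness, so the pairs
    are chosen along \<open><\<close>.\<close>
  proof (rule dependent_wf_choice[OF wf_less])
    fix f g :: "nat \<Rightarrow> bool \<times> bool" and m r
    assume "\<And>z. (z, m) \<in> {(x, y). x < y} \<Longrightarrow> f z = g z"
    then show "S f m r = S g m r"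
      using proper_divisors_in_cong[of m "fst \<circ> f" "fst \<circ> g"]
        proper_divisors_in_cong[of m "snd \<circ> f" "snd \<circ> g"]
      by (simp add: S_def)
  next
    fix m and f :: "nat \<Rightarrow> bool \<times> bool"
    show "\<exists>r. S f m r"
      using antitone_bool_pair
        [where F = "\<lambda>c. practical_set (insert_if c m (proper_divisors_in (fst \<circ> f) m))"
          and G = "\<lambda>c. practical_set (insert_if c m (proper_divisors_in (snd \<circ> f) m))",
          OF practical_set_insert_if_antitone practical_set_insert_if_antitone]
      by (simp add: S_def)
  qed
  then obtain f where f: "\<And>m. S f m (f m)" by blast
  let ?A = "{n. 0 < n \<and> (fst \<circ> f) n}" and ?B = "{n. 0 < n \<and> (snd \<circ> f) n}"
  have "Pr ?A = ?B"
    using f[unfolded S_def, THEN conjunct1] unfolding o_def by (rule Pr_Collect_eq)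
  moreover have "Pr ?B = ?A"
    using f[unfolded S_def, THEN conjunct2] unfolding o_def by (rule Pr_Collect_eq)
  ultimately have "?A \<subseteq> {0<..} \<and> ?A = Pr (Pr ?A)" by auto
  then show ?thesis by blast
qed

end
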